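(* Let $n_1\in(0,\infty)$ and let $0\le K\le N$ be real numbers. Then the function $\mathbb{N}_{\ge 1}\to\mathbb{R}$, $$n_m\mapsto I_{\frac{n_1+N}{n_1+N+n_m}}(n_1+K,n_m),$$ is strictly increasing.
   Context: $I_x(a,b)$ denotes the regularized (lower) incomplete beta function: for $a,b>0$ and $x\in[0,1]$, $$I_x(a,b)=\frac{\Gamma(a+b)}{\Gamma(a)\Gamma(b)}\int_0^x t^{a-1}(1-t)^{b-1}\,dt.$$ Here $n_m$ is simply the name of the integer variable in $\mathbb{N}_{\ge 1}=\{1,2,3,\ldots\}$. *)

theory Defs
  imports "HOL-Analysis.Analysis"
begin

(* Meaningful for a, b > 0 and 0 \<le> x \<le> 1.  Since 0 powr c = 0, the integrand is 0 at the
   endpoints t = 0 and t = 1, which does not affect the integral. *)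
definition incomplete_beta_reg :: "real \<Rightarrow> real \<Rightarrow> real \<Rightarrow> real" where
  "incomplete_beta_reg x a b =
     Gamma (a + b) / (Gamma a * Gamma b) *
     integral {0..x} (\<lambda>t. t powr (a - 1) * (1 - t) powr (b - 1))"

end

theory Submission
  imports Defs
begin

text \<open>
  Put \<open>a = n\<^sub>1 + K\<close>, \<open>s = n\<^sub>1 + N\<close>, \<open>x = s / (s + m)\<close> and \<open>y = s / (s + m + 1)\<close>.
  The recurrence for the incomplete beta function in its second parameter reduces the step
  from \<open>m\<close> to \<open>m + 1\<close> to
  \<open>(a + m) \<integral>\<^sub>y\<^sup>x t\<^sup>a\<^sup>-\<^sup>1 (1 - t)\<^sup>m dt < x\<^sup>a (1 - x)\<^sup>m\<close>.
  Since \<open>\<integral>\<^sub>y\<^sup>x s / t\<^sup>2 dt = 1\<close>, it is enough that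
  \<open>(a + m) t\<^sup>a\<^sup>-\<^sup>1 (1 - t)\<^sup>m < x\<^sup>a (1 - x)\<^sup>m s / t\<^sup>2\<close> on \<open>(y, x)\<close>, and in the variable \<open>u\<close> with
  \<open>t = s / (s + u)\<close> this follows from elementary bounds for the logarithm.
\<close>

lemma beta_integrand_integrable:
  fixes a b x :: real
  assumes "0 < a" "0 < b" "0 \<le> x" "x \<le> 1"
  shows "(\<lambda>t. t powr (a - 1) * (1 - t) powr (b - 1)) integrable_on {0..x}"
  by (rule integrable_subinterval_real[OF has_integral_integrable[OF has_integral_Beta_real]])
    (use assms in auto)

text \<open>Integrate the derivative of \<open>t powr a * (1 - t) powr b\<close>: splitting one
  factor \<open>t\<close> and one factor \<open>1 - t\<close> off the powers turns it into a
  combination of the two integrands.\<close>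

lemma incomplete_beta_integral_recurrence:
  fixes a b x :: real
  assumes "0 < a" "0 < b" "0 \<le> x" "x < 1"
  shows "(a + b) * integral {0..x} (\<lambda>t. t powr (a - 1) * (1 - t) powr b)
       - b * integral {0..x} (\<lambda>t. t powr (a - 1) * (1 - t) powr (b - 1))
       = x powr a * (1 - x) powr b"
proof -
  let ?f = "\<lambda>c t::real. t powr (a - 1) * (1 - t) powr c"
  have "((\<lambda>t. (a + b) * ?f b t - b * ?f (b - 1) t) has_integral
          x powr a * (1 - x) powr b - 0 powr a * (1 - 0) powr b) {0..x}"
  \<comment> \<open>For \<open>a < 1\<close> the antiderivative is not differentiable at 0, so only
    continuity is asked for at the endpoints.\<close>
  proof (rule fundamental_theorem_of_calculus_interior)
    show "continuous_on {0..x} (\<lambda>t. t powr a * (1 - t) powr b)"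
      using assms by (intro continuous_intros continuous_on_powr') auto
  next
    fix t assume t: "t \<in> {0<..<x}"
    have "((\<lambda>t. t powr a * (1 - t) powr b) has_real_derivative
            a * t powr (a - 1) * (1 - t) powr b - t powr a * (b * (1 - t) powr (b - 1))) (at t)"
      using t assms by (auto intro!: derivative_eq_intros)
    moreover have "a * t powr (a - 1) * (1 - t) powr b - t powr a * (b * (1 - t) powr (b - 1))
        = (a + b) * ?f b t - b * ?f (b - 1) t"
    proof -
      have eq: "t powr a = t * t powr (a - 1)" "(1 - t) powr b = (1 - t) * (1 - t) powr (b - 1)"
        using t assms by (simp_all add: powr_diff)
      show ?thesis unfolding eq by (simp add: algebra_simps)
    qed
    ultimately show "((\<lambda>t. t powr a * (1 - t) powr b) has_vector_derivative
            (a + b) * ?f b t - b * ?f (b - 1) t) (at t)"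
      by (simp only: has_real_derivative_iff_has_vector_derivative)
  qed (use assms in auto)
  hence "integral {0..x} (\<lambda>t. (a + b) * ?f b t - b * ?f (b - 1) t) = x powr a * (1 - x) powr b"
    using assms by (simp add: integral_unique)
  moreover have "?f b integrable_on {0..x}" "?f (b - 1) integrable_on {0..x}"
    using beta_integrand_integrable[of a "b + 1" x] beta_integrand_integrable[of a b x] assms
    by auto
  hence "integral {0..x} (\<lambda>t. (a + b) * ?f b t - b * ?f (b - 1) t)
      = (a + b) * integral {0..x} (?f b) - b * integral {0..x} (?f (b - 1))"
    by (subst integral_diff) (auto intro: integrable_on_mult_right)
  ultimately show ?thesis by simp
qed

text \<open>This is the logarithmic form of the pointwise bound at \<open>t = s / (s + u)\<close>.
  The left side is below \<open>u - m\<close>; since \<open>s + u \<le> s + m + 1\<close>, this is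
  at most \<open>(s + m + 1) * p\<close>, where \<open>p\<close> is the first logarithm on the
  right.\<close>

lemma beta_log_inequality:
  fixes a s m u :: real
  assumes "0 < a" "a \<le> s" "0 < m" "m < u" "u \<le> m + 1"
  shows "m * ln (u / m) < (a + m + 1) * ln ((s + u) / (s + m)) + ln ((s + m) / (a + m))"
proof -
  define p where "p = ln ((s + u) / (s + m))"
  have "ln (1 + (u - m) / m) < (u - m) / m"
    using assms by (intro ln_add_one_self_less_self) auto
  moreover have "1 + (u - m) / m = u / m" using assms by (simp add: field_simps)
  ultimately have "m * ln (u / m) < u - m" using assms by (simp add: field_simps)
  also have "u - m \<le> (s + m + 1) * ((u - m) / (s + u))"
  proof -
    have "(u - m) * (s + u) \<le> (u - m) * (s + m + 1)" using assms by (intro mult_left_mono) auto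
    thus ?thesis using assms by (simp add: field_simps)
  qed
  also have "(u - m) / (s + u) \<le> p"
  proof -
    have "ln ((s + m) / (s + u)) \<le> (s + m) / (s + u) - 1"
      using assms by (intro ln_le_minus_one) auto
    moreover have "ln ((s + m) / (s + u)) = - p"
      using assms by (simp add: p_def ln_div)
    ultimately show ?thesis using assms by (simp add: field_simps)
  qed
  hence "(s + m + 1) * ((u - m) / (s + u)) \<le> (s + m + 1) * p"
    using assms by (intro mult_left_mono) auto
  \<comment> \<open>The surplus \<open>(s - a) * p\<close> is absorbed by the last logarithm:
    \<open>(s - a) / (s + m)\<close> lies between them, by \<open>ln z \<le> z - 1\<close> used
    twice and \<open>u - m \<le> 1\<close>.\<close>
  also have "\<dots> = (a + m + 1) * p + (s - a) * p" by (simp add: algebra_simps)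
  also have "(s - a) * p \<le> ln ((s + m) / (a + m))"
  proof -
    have "p \<le> (s + u) / (s + m) - 1"
      unfolding p_def using assms by (intro ln_le_minus_one) auto
    also have "\<dots> = (u - m) / (s + m)" using assms by (simp add: field_simps)
    also have "\<dots> \<le> 1 / (s + m)" using assms by (intro divide_right_mono) auto
    finally have "(s - a) * p \<le> (s - a) * (1 / (s + m))"
      using assms by (intro mult_left_mono) auto
    moreover have "ln ((a + m) / (s + m)) \<le> (a + m) / (s + m) - 1"
      using assms by (intro ln_le_minus_one) auto
    moreover have "ln ((a + m) / (s + m)) = - ln ((s + m) / (a + m))"
      using assms by (simp add: ln_div)
    moreover have "1 - (a + m) / (s + m) = (s - a) * (1 / (s + m))"
      using assms by (simp add: field_simps)
    ultimately show ?thesis by linarith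
  qed
  finally show ?thesis by (simp add: p_def)
qed

lemma beta_integrand_bound:
  fixes a s m t x :: real
  assumes "0 < a" "a \<le> s" "0 < m" and x: "x = s / (s + m)"
    and t: "s / (s + m + 1) \<le> t" "t < x"
  shows "(a + m) * (t powr (a - 1) * (1 - t) powr m) < x powr a * (1 - x) powr m * (s / t\<^sup>2)"
proof -
  define u where "u = s / t - s"
  have "0 < s / (s + m + 1)" using assms by simp
  hence t0: "0 < t" using t by linarith
  have x1: "0 < x" "x < 1" using assms by (auto simp: x field_simps)
  have t1: "t < 1" using t x1 by simp
  have u: "m < u" "u \<le> m + 1"
    using assms t0 by (auto simp: u_def x field_simps)
  have tu: "t = s / (s + u)" using assms t0 by (simp add: u_def field_simps)
  have lt: "ln t = ln s - ln (s + u)" using assms u by (simp add: tu ln_div)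
  have "1 - t = u / (s + u)" using assms u by (simp add: tu field_simps)
  hence l1t: "ln (1 - t) = ln u - ln (s + u)" using assms u by (simp add: ln_div)
  have lx: "ln x = ln s - ln (s + m)" using assms by (simp add: x ln_div)
  have "1 - x = m / (s + m)" using assms by (simp add: x field_simps)
  hence l1x: "ln (1 - x) = ln m - ln (s + m)" using assms by (simp add: ln_div)
  have "m * (ln u - ln m) <
      (a + m + 1) * (ln (s + u) - ln (s + m)) + (ln (s + m) - ln (a + m))"
    using beta_log_inequality[of a s m u] assms u by (simp add: ln_div)
  \<comment> \<open>The terms in \<open>ln s\<close> cancel, because the weight
    \<open>s / t\<^sup>2\<close> adds \<open>1 - 2\<close> to the coefficient \<open>a\<close>. Its
    \<open>- 2 * ln t\<close> also brings the coefficient of \<open>ln (s + u)\<close> to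
    \<open>a + m + 1\<close>.\<close>
  hence "ln (a + m) + (a - 1) * ln t + m * ln (1 - t)
      < a * ln x + m * ln (1 - x) + ln s - 2 * ln t"
    unfolding lt l1t lx l1x by (simp add: algebra_simps)
  moreover have "ln ((a + m) * (t powr (a - 1) * (1 - t) powr m))
      = ln (a + m) + (a - 1) * ln t + m * ln (1 - t)"
    using \<open>0 < a\<close> \<open>0 < m\<close> t0 t1 by (simp add: ln_mult ln_powr)
  moreover have "ln (x powr a * (1 - x) powr m * (s / t\<^sup>2))
      = a * ln x + m * ln (1 - x) + ln s - 2 * ln t"
    using assms t0 t1 x1 by (simp add: ln_mult ln_powr ln_div ln_realpow)
  ultimately have "ln ((a + m) * (t powr (a - 1) * (1 - t) powr m))
      < ln (x powr a * (1 - x) powr m * (s / t\<^sup>2))" by simp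
  moreover have "0 < (a + m) * (t powr (a - 1) * (1 - t) powr m)"
    using \<open>0 < a\<close> \<open>0 < m\<close> t0 t1 by simp
  moreover have "0 < x powr a * (1 - x) powr m * (s / t\<^sup>2)"
    using \<open>0 < a\<close> \<open>a \<le> s\<close> t0 x1 by simp
  ultimately show ?thesis by simp
qed

lemma beta_integral_bound:
  fixes a s m x y :: real
  assumes "0 < a" "a \<le> s" "0 < m" and x: "x = s / (s + m)" and y: "y = s / (s + m + 1)"
  shows "(a + m) * integral {y..x} (\<lambda>t. t powr (a - 1) * (1 - t) powr m)
       < x powr a * (1 - x) powr m"
proof -
  let ?C = "x powr a * (1 - x) powr m"
  have xy: "0 < y" "y < x" "x < 1"
    using assms by (auto simp: x y intro!: divide_strict_left_mono)
  \<comment> \<open>The weight has antiderivative \<open>- s / t\<close>, and \<open>s / t\<close>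
    drops by exactly 1 from \<open>y\<close> to \<open>x\<close>.\<close>
  have "((\<lambda>t. ?C * (s / t\<^sup>2)) has_integral (- ?C * s / x) - (- ?C * s / y)) {y..x}"
    using xy unfolding power2_eq_square
    by (intro fundamental_theorem_of_calculus)
      (auto intro!: derivative_eq_intros
        simp: has_real_derivative_iff_has_vector_derivative[symmetric] field_simps)
  moreover have "s / x = s + m" "s / y = s + m + 1" using assms by (auto simp: x y)
  hence "(- ?C * s / x) - (- ?C * s / y) = ?C"
    by (simp only: times_divide_eq_right[symmetric]) (simp add: algebra_simps)
  ultimately have I: "integral {y..x} (\<lambda>t. ?C * (s / t\<^sup>2)) = ?C" by (simp only: integral_unique)
  have "integral {y..x} (\<lambda>t. (a + m) * (t powr (a - 1) * (1 - t) powr m))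
      < integral {y..x} (\<lambda>t. ?C * (s / t\<^sup>2))"
  \<comment> \<open>Strictness is needed only in the open interval; for \<open>a = s\<close> the two
    integrands agree at \<open>t = x\<close>.\<close>
  proof (rule integral_less_real)
    show "continuous_on {y..x} (\<lambda>t. (a + m) * (t powr (a - 1) * (1 - t) powr m))"
      "continuous_on {y..x} (\<lambda>t. ?C * (s / t\<^sup>2))"
      using xy by (auto intro!: continuous_intros)
    show "{y<..<x} \<noteq> {}" using xy by simp
  qed (use assms beta_integrand_bound in auto)
  thus ?thesis unfolding I by simp
qed

lemma incomplete_beta_reg_less_step:
  fixes a s m :: real
  assumes "0 < a" "a \<le> s" "0 < m"
  shows "incomplete_beta_reg (s / (s + m)) a m < incomplete_beta_reg (s / (s + (m + 1))) a (m + 1)"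
proof -
  define x y where "x = s / (s + m)" and "y = s / (s + m + 1)"
  \<comment> \<open>The exponent \<open>m\<close> belongs to the second parameter
    \<open>m + 1\<close>.\<close>
  let ?J = "\<lambda>z. integral {0..z} (\<lambda>t. t powr (a - 1) * (1 - t) powr m)"
  define c where "c = Gamma (a + m) / (Gamma a * Gamma m)"
  have xy: "0 < y" "y < x" "x < 1"
    using assms by (auto simp: x_def y_def intro!: divide_strict_left_mono)
  have c: "0 < c" using assms by (simp add: c_def)
  have "a + m \<notin> \<int>\<^sub>\<le>\<^sub>0" "m \<notin> \<int>\<^sub>\<le>\<^sub>0"
    using assms by (auto elim!: nonpos_Ints_cases)
  hence "Gamma (a + (m + 1)) = (a + m) * Gamma (a + m)" "Gamma (m + 1) = m * Gamma m"
    using Gamma_plus1[of "a + m"] Gamma_plus1[of m] by (simp_all add: add.assoc)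
  \<comment> \<open>With \<open>c / m\<close> factored out of both normalizations, the recurrence
    expresses the two sides through \<open>?J x\<close> and \<open>?J y\<close> alone, up to the
    boundary term at \<open>x\<close>.\<close>
  hence c': "Gamma (a + (m + 1)) / (Gamma a * Gamma (m + 1)) = c / m * (a + m)"
    by (simp add: c_def mult_ac)
  have "?J y + integral {y..x} (\<lambda>t. t powr (a - 1) * (1 - t) powr m) = ?J x"
    using xy assms beta_integrand_integrable[of a "m + 1" x]
    by (intro Henstock_Kurzweil_Integration.integral_combine) auto
  hence "(a + m) * ?J x
      = (a + m) * ?J y + (a + m) * integral {y..x} (\<lambda>t. t powr (a - 1) * (1 - t) powr m)"
    by (simp flip: distrib_left)
  hence less: "(a + m) * ?J x - x powr a * (1 - x) powr m < (a + m) * ?J y"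
    using beta_integral_bound[OF assms x_def y_def] by linarith
  have "incomplete_beta_reg x a m
      = c / m * (m * integral {0..x} (\<lambda>t. t powr (a - 1) * (1 - t) powr (m - 1)))"
    using assms by (simp add: incomplete_beta_reg_def c_def)
  also have "\<dots> = c / m * ((a + m) * ?J x - x powr a * (1 - x) powr m)"
    using incomplete_beta_integral_recurrence[of a m x] assms xy
    by (intro arg_cong[of _ _ "(*) (c / m)"]) linarith
  also have "\<dots> < c / m * ((a + m) * ?J y)"
    using less c assms by (intro mult_strict_left_mono) auto
  also have "\<dots> = incomplete_beta_reg y a (m + 1)"
    unfolding incomplete_beta_reg_def c' by simp
  finally show ?thesis by (simp add: x_def y_def add.assoc)
qed

theorem lemma18:
  fixes n\<^sub>1 K N :: real
  assumes "0 < n\<^sub>1" and "0 \<le> K" and "K \<le> N"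
  shows "strict_mono_on {1..} (\<lambda>n\<^sub>m::nat.
           incomplete_beta_reg ((n\<^sub>1 + N) / (n\<^sub>1 + N + real n\<^sub>m)) (n\<^sub>1 + K) (real n\<^sub>m))"
proof (rule strict_mono_onI)
  fix i j :: nat
  assume "i \<in> {1..}" "i < j"
  let ?F = "\<lambda>n::nat. incomplete_beta_reg ((n\<^sub>1 + N) / (n\<^sub>1 + N + real n)) (n\<^sub>1 + K) (real n)"
  have step: "?F n < ?F (Suc n)" if "1 \<le> n" for n
    using incomplete_beta_reg_less_step[of "n\<^sub>1 + K" "n\<^sub>1 + N" "real n"] assms that
    by (simp add: add.commute)
  \<comment> \<open>Starting the induction at \<open>Suc i\<close> makes its base case a single
    strict step.\<close>
  have "Suc i \<le> j" using \<open>i < j\<close> by simp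
  thus "?F i < ?F j"
  proof (induction j rule: dec_induct)
    case base
    show ?case using step \<open>i \<in> {1..}\<close> by simp
  next
    case (step k)
    thus ?case using \<open>i \<in> {1..}\<close> \<open>\<And>n. 1 \<le> n \<Longrightarrow> ?F n < ?F (Suc n)\<close>[of k] by simp
  qed
qed

end
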